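(* Let $m\ge d\ge 1$ be integers, let $X$ be an $m\times d$ real matrix with pairwise distinct rows $\mathbf{x}_1^T,\ldots,\mathbf{x}_m^T$, and let $w_1,\ldots,w_m>0$ be fixed real numbers. Let $\mathbf{I}=\{i_1,\ldots,i_d\}\subset\{1,\ldots,m\}$ be an index set (of $d$ distinct indices) satisfying $|X[i_1,\ldots,i_d]|\ne 0$. Then the saturated design satisfying $p_{i_1}=p_{i_2}=\cdots=p_{i_d}=\frac1d$ (and hence $p_i=0$ for $i\notin\mathbf{I}$) is D-optimal if and only if for each $i\in\{1,\ldots,m\}$ with $i\notin\mathbf{I}$, $$\sum_{j\in\mathbf{I}}\frac{\left|X[\{i\}\cup\mathbf{I}\setminus\{j\}]\right|^2}{w_j}\le\frac{\left|X[i_1,i_2,\ldots,i_d]\right|^2}{w_i}.$$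
   Context: Setting: in a generalized linear model with $m$ distinct design points $\mathbf{x}_1,\ldots,\mathbf{x}_m\in\mathbb{R}^d$, a single-parameter exponential family response, link function $g$, and linear predictors $\eta_i=\mathbf{x}_i^T\boldsymbol\beta$, the numbers $w_i=\frac{1}{\mathrm{var}(Y_i)}\left(\frac{\partial\mu_i}{\partial\eta_i}\right)^2$ (where $\mu_i=E(Y_i)$) are treated as known positive constants (local optimality). The Fisher information matrix is $nX'WX$, where $X=(\mathbf{x}_1,\ldots,\mathbf{x}_m)^T$ and $W=\mathrm{diag}(p_1w_1,\ldots,p_mw_m)$. Only the positivity of the constants $w_i$ and the matrix $X$ enter the claim. Notation: $|\cdot|$ is the determinant and $'$ denotes transpose. For a set of $d$ distinct indices $k_1<\cdots<k_d$ in $\{1,\ldots,m\}$, $X[k_1,\ldots,k_d]=X[\{k_1,\ldots,k_d\}]$ is the $d\times d$ submatrix of $X$ consisting of rows $k_1,\ldots,k_d$ (only squared determinants and nonvanishing of determinants are used, so the order of the rows is irrelevant). For $j\in\mathbf{I}$ and $i\notin\mathbf{I}$, $\{i\}\cup\mathbf{I}\setminus\{j\}$ is the set obtained from $\mathbf{I}$ by replacing $j$ with $i$. An allocation (approximate design) is a vector $\mathbf{p}=(p_1,\ldots,p_m)'$ with $p_i\ge 0$ for all $i$ and $p_1+\cdots+p_m=1$. An allocation is (locally) D-optimal if it maximizes $f(\mathbf{p})=|X'WX|$ over all allocations. A saturated (minimally supported) design is one whose number of support points equals the number $d$ of parameters. *)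

theory Defs
  imports Complex_Main "Jordan_Normal_Form.Determinant" "Jordan_Normal_Form.DL_Submatrix"
begin

text \<open>
  Design points are the rows of the \<open>m \<times> d\<close> model matrix \<open>X\<close>, indexed from \<open>0\<close> to \<open>m - 1\<close>.
  \<open>w i\<close> is the (locally known) constant \<open>(\<partial>\<mu>\<^sub>i/\<partial>\<eta>\<^sub>i)\<^sup>2 / var(Y\<^sub>i)\<close>; only its values for \<open>i < m\<close> matter.
  The submatrix of \<open>X\<close> on a set \<open>K\<close> of rows (in increasing order) is \<open>submatrix X K UNIV\<close>.
\<close>

definition allocation :: "nat \<Rightarrow> real vec \<Rightarrow> bool" where
  "allocation m p \<longleftrightarrow> p \<in> carrier_vec m \<and> (\<forall>i<m. p $ i \<ge> 0) \<and> (\<Sum>i<m. p $ i) = 1"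

text \<open>The Fisher information matrix up to the sample size \<open>n\<close>: \<open>X' W X\<close> with \<open>W = diag(p\<^sub>i w\<^sub>i)\<close>.\<close>

definition information_mat :: "real mat \<Rightarrow> (nat \<Rightarrow> real) \<Rightarrow> real vec \<Rightarrow> real mat" where
  "information_mat X w p =
     transpose_mat X * mat_diag (dim_row X) (\<lambda>i. p $ i * w i) * X"

definition D_optimal :: "real mat \<Rightarrow> (nat \<Rightarrow> real) \<Rightarrow> real vec \<Rightarrow> bool" where
  "D_optimal X w p \<longleftrightarrow>
     allocation (dim_row X) p \<and>
     (\<forall>q. allocation (dim_row X) q \<longrightarrow>
        det (information_mat X w q) \<le> det (information_mat X w p))"

definition uniform_design :: "nat \<Rightarrow> nat set \<Rightarrow> real vec" where
  "uniform_design m I = vec m (\<lambda>i. if i \<in> I then 1 / real (card I) else 0)"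

lemma allocation_uniform_design:
  assumes "I \<subseteq> {..<m}" and "I \<noteq> {}"
  shows "allocation m (uniform_design m I)"
proof -
  have fin: "finite I" using assms(1) finite_subset by blast
  have "(\<Sum>i<m. uniform_design m I $ i) = (\<Sum>i<m. if i \<in> I then 1 / real (card I) else 0)"
    by (intro sum.cong) (auto simp: uniform_design_def)
  also have "\<dots> = (\<Sum>i\<in>I. 1 / real (card I))"
    using assms(1) by (simp add: sum.If_cases Int_absorb1)
  also have "\<dots> = 1"
    using fin assms(2) by simp
  finally show ?thesis
    by (auto simp: allocation_def uniform_design_def)
qed

text \<open>
  The number of support points of \<open>uniform_design m I\<close> is \<open>card I\<close>, so it is saturated for
  \<open>d = card I\<close> parameters.
\<close>

lemma support_uniform_design:
  assumes "I \<subseteq> {..<m}"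
  shows "{i. i < m \<and> uniform_design m I $ i > 0} = I"
proof -
  have "finite I" using assms finite_subset by blast
  then show ?thesis
    using assms by (auto simp: uniform_design_def card_gt_0_iff split: if_splits)
qed

end

theory Submission
  imports Defs
begin

text \<open>
  Scale the rows of \<open>X\<close> by \<open>sqrt (w i)\<close> and change the basis of the parameter space so that the rows
  in \<open>I\<close> become the unit vectors; write \<open>z\<^sub>i\<close> for the resulting rows. The information determinant becomes
  a positive constant times \<open>det (\<Sum>\<^sub>i q\<^sub>i z\<^sub>i z\<^sub>i\<^sup>T)\<close>, and by Cramer's rule the stated inequality at \<open>i\<close>
  says \<open>|z\<^sub>i|\<^sup>2 \<le> 1\<close>. If it holds for all \<open>i\<close>, the Gram matrix has trace at most \<open>1\<close>, hence determinant at
  most \<open>d\<^bsup>-d\<^esup>\<close> by Hadamard's inequality and AM-GM, with equality for the uniform design. Conversely, moving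
  mass \<open>t\<close> from the uniform design to \<open>i\<close> is a rank-one change, and the first-order term of the determinant
  in \<open>t\<close> is positive if \<open>|z\<^sub>i|\<^sup>2 > 1\<close>.
\<close>

section \<open>Schur complements and Hadamard's inequality\<close>

text \<open>One step of Gaussian elimination as a block factorization: \<open>?L\<close> is unit
  lower triangular with the multipliers \<open>?C\<close>, and \<open>?U\<close> is block upper
  triangular with the pivot in the corner.\<close>

lemma det_schur_complement:
  fixes f :: "nat \<Rightarrow> nat \<Rightarrow> 'a::field"
  assumes nz: "f 0 0 \<noteq> 0"
  shows "det (mat (Suc n) (Suc n) (\<lambda>(i, j). f i j)) =
    f 0 0 * det (mat n n (\<lambda>(i, j). f (Suc i) (Suc j) - f (Suc i) 0 * f 0 (Suc j) / f 0 0))"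
    (is "det ?M = _ * det ?S")
proof -
  let ?C = "mat n 1 (\<lambda>(i, j). f (Suc i) 0 / f 0 0)"
  let ?R = "mat 1 n (\<lambda>(i, j). f 0 (Suc j))"
  let ?A = "mat 1 1 (\<lambda>(i, j). f 0 0)"
  let ?L = "four_block_mat (1\<^sub>m 1) (0\<^sub>m 1 n) ?C (1\<^sub>m n)"
  let ?U = "four_block_mat ?A ?R (0\<^sub>m n 1) ?S"
  have "?L * ?U = four_block_mat (1\<^sub>m 1 * ?A + 0\<^sub>m 1 n * 0\<^sub>m n 1) (1\<^sub>m 1 * ?R + 0\<^sub>m 1 n * ?S)
      (?C * ?A + 1\<^sub>m n * 0\<^sub>m n 1) (?C * ?R + 1\<^sub>m n * ?S)"
    by (rule mult_four_block_mat) auto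
  also have "\<dots> = ?M"
  proof (rule eq_matI)
    fix i j assume "i < dim_row ?M" "j < dim_col ?M"
    then show "four_block_mat (1\<^sub>m 1 * ?A + 0\<^sub>m 1 n * 0\<^sub>m n 1) (1\<^sub>m 1 * ?R + 0\<^sub>m 1 n * ?S)
      (?C * ?A + 1\<^sub>m n * 0\<^sub>m n 1) (?C * ?R + 1\<^sub>m n * ?S) $$ (i, j) = ?M $$ (i, j)"
      using nz by (cases i; cases j) (auto simp: scalar_prod_def)
  qed auto
  finally have M: "?M = ?L * ?U" by simp
  have "det ?M = det ?L * det ?U"
    unfolding M by (rule det_mult[of _ "1 + n"]) (rule four_block_carrier_mat; simp)+
  moreover have "det ?L = det (1\<^sub>m 1) * det (1\<^sub>m n)"
    by (rule det_four_block_mat_upper_right_zero) auto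
  moreover have "det ?U = det ?A * det ?S"
    by (rule det_four_block_mat_lower_left_zero) auto
  moreover have "det ?A = f 0 0" by (simp add: det_single)
  ultimately show ?thesis by simp
qed

text \<open>Hadamard's inequality for a Gram matrix. The Schur complement of a Gram matrix is the Gram
  matrix of the projections onto the complement of the first vector, so induction applies.\<close>

lemma det_gram_le_prod:
  fixes f :: "'k \<Rightarrow> nat \<Rightarrow> real"
  shows "det (mat n n (\<lambda>(i, j). \<Sum>k\<in>K. f k i * f k j)) \<le> (\<Prod>i<n. \<Sum>k\<in>K. (f k i)\<^sup>2)"
proof (induction n arbitrary: f)
  case 0
  then show ?case by simp
next
  case (Suc n)
  define G where "G i j = (\<Sum>k\<in>K. f k i * f k j)" for i j
  have sym: "G i j = G j i" for i j by (simp add: G_def mult.commute)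
  have G_diag: "(\<Sum>k\<in>K. (f k i)\<^sup>2) = G i i" for i by (simp add: G_def power2_eq_square)
  have nonneg: "0 \<le> G i i" for i unfolding G_diag[symmetric] by (simp add: sum_nonneg)
  show ?case
  proof (cases "G 0 0 = 0")
    case True
    have zero: "G 0 j = 0" for j
    \<comment> \<open>Sums over an infinite \<open>K\<close> default to 0; for finite
      \<open>K\<close>, a vanishing sum of squares forces every \<open>f k 0\<close> to be
      0.\<close>
    proof (cases "finite K")
      case fin: True
      with True have "\<forall>k\<in>K. (f k 0)\<^sup>2 = 0"
        unfolding G_diag[symmetric] by (subst (asm) sum_nonneg_eq_0_iff) auto
      then show ?thesis by (simp add: G_def)
    qed (simp add: G_def)
    have "det (mat (Suc n) (Suc n) (\<lambda>(i, j). G i j)) = 0"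
    \<comment> \<open>Row 0 vanishes, so every Leibniz term contains a zero factor at index
      0.\<close>
    proof (subst det_def'[of _ "Suc n"])
      show "(\<Sum>p | p permutes {0..<Suc n}. signof p *
          (\<Prod>i = 0..<Suc n. mat (Suc n) (Suc n) (\<lambda>(i, j). G i j) $$ (i, p i))) = 0"
      proof (intro sum.neutral ballI)
        fix p assume "p \<in> {p. p permutes {0..<Suc n}}"
        then have "p 0 < Suc n" using permutes_in_image[of p "{0..<Suc n}" 0] by simp
        then have "\<exists>i\<in>{0..<Suc n}. mat (Suc n) (Suc n) (\<lambda>(i, j). G i j) $$ (i, p i) = 0"
          by (intro bexI[of _ 0]) (simp_all add: zero)
        then show "signof p * (\<Prod>i = 0..<Suc n. mat (Suc n) (Suc n) (\<lambda>(i, j). G i j) $$ (i, p i)) = 0"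
          by (simp only: prod_zero[OF finite_atLeastLessThan] mult_zero_right)
      qed
    qed simp
    then show ?thesis
      unfolding G_diag by (simp add: G_def[symmetric] prod_nonneg nonneg)
  next
    case False
    with nonneg[of 0] have pos: "0 < G 0 0" by simp
    define h where "h k i = f k (Suc i) - f k 0 * G 0 (Suc i) / G 0 0" for k i
    have h: "(\<Sum>k\<in>K. h k i * h k j) = G (Suc i) (Suc j) - G (Suc i) 0 * G 0 (Suc j) / G 0 0" for i j
    proof -
      let ?a = "G 0 (Suc i) / G 0 0" and ?b = "G 0 (Suc j) / G 0 0"
      have "(\<Sum>k\<in>K. h k i * h k j) = (\<Sum>k\<in>K. f k (Suc i) * f k (Suc j) - ?b * (f k (Suc i) * f k 0)
          - ?a * (f k 0 * f k (Suc j)) + ?a * ?b * (f k 0 * f k 0))"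
        by (rule sum.cong) (auto simp: h_def algebra_simps)
      also have "\<dots> = G (Suc i) (Suc j) - ?b * G (Suc i) 0 - ?a * G 0 (Suc j) + ?a * ?b * G 0 0"
        by (simp add: sum.distrib sum_subtractf sum_distrib_left G_def)
      finally show ?thesis using pos sym[of "Suc i" 0] by simp
    qed
    have "det (mat (Suc n) (Suc n) (\<lambda>(i, j). G i j)) =
        G 0 0 * det (mat n n (\<lambda>(i, j). \<Sum>k\<in>K. h k i * h k j))"
      unfolding h by (rule det_schur_complement) (use pos in simp)
    also have "\<dots> \<le> G 0 0 * (\<Prod>i<n. \<Sum>k\<in>K. (h k i)\<^sup>2)"
      using pos Suc.IH[of h] by simp
    also have "(\<Prod>i<n. \<Sum>k\<in>K. (h k i)\<^sup>2) \<le> (\<Prod>i<n. G (Suc i) (Suc i))"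
    proof (rule prod_mono, safe)
      fix i
      show "(\<Sum>k\<in>K. (h k i)\<^sup>2) \<le> G (Suc i) (Suc i)"
        using h[of i i] sym[of "Suc i" 0] pos by (simp add: power2_eq_square)
    qed (simp add: sum_nonneg)
    finally show ?thesis
      using pos unfolding G_diag by (simp add: G_def[symmetric] prod.lessThan_Suc_shift del: prod.lessThan_Suc)
  qed
qed

section \<open>Rank-one updates of a determinant\<close>

text \<open>Sylvester's identity. The block matrices satisfy \<open>?P * ?Q = ?S * ?P\<close> with
  \<open>det ?P = 1\<close>, so \<open>?Q\<close> and \<open>?S\<close> have equal
  determinants.\<close>

lemma det_one_plus_mult_commute:
  fixes A B :: "'a::idom mat"
  assumes A: "A \<in> carrier_mat n m" and B: "B \<in> carrier_mat m n"
  shows "det (1\<^sub>m n + A * B) = det (1\<^sub>m m + B * A)"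
proof -
  let ?P = "four_block_mat (1\<^sub>m n) (0\<^sub>m n m) B (1\<^sub>m m)"
  let ?Q = "four_block_mat (1\<^sub>m n + A * B) A (0\<^sub>m m n) (1\<^sub>m m)"
  let ?S = "four_block_mat (1\<^sub>m n) A (0\<^sub>m m n) (1\<^sub>m m + B * A)"
  note car = A B
  have "?P * ?Q = four_block_mat (1\<^sub>m n * (1\<^sub>m n + A * B) + 0\<^sub>m n m * 0\<^sub>m m n) (1\<^sub>m n * A + 0\<^sub>m n m * 1\<^sub>m m)
      (B * (1\<^sub>m n + A * B) + 1\<^sub>m m * 0\<^sub>m m n) (B * A + 1\<^sub>m m * 1\<^sub>m m)"
    by (rule mult_four_block_mat) (use car in auto)
  also have "\<dots> = four_block_mat (1\<^sub>m n * 1\<^sub>m n + A * B) (1\<^sub>m n * 0\<^sub>m n m + A * 1\<^sub>m m)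
      (0\<^sub>m m n * 1\<^sub>m n + (1\<^sub>m m + B * A) * B) (0\<^sub>m m n * 0\<^sub>m n m + (1\<^sub>m m + B * A) * 1\<^sub>m m)"
  proof -
    have "B * (1\<^sub>m n + A * B) = (1\<^sub>m m + B * A) * B"
      using car by (simp add: mult_add_distrib_mat[of _ m n _ n] add_mult_distrib_mat[of _ m m _ _ n])
    moreover have "B * A + 1\<^sub>m m = 1\<^sub>m m + B * A"
      using car by (simp add: comm_add_mat[of _ m m])
    moreover have "(1\<^sub>m m + B * A) * B \<in> carrier_mat m n"
      by (rule mult_carrier_mat) (use car in auto)
    ultimately show ?thesis using car by simp
  qed
  also have "\<dots> = ?S * ?P"
    by (rule mult_four_block_mat[symmetric]) (use car in auto)
  finally have "det (?P * ?Q) = det (?S * ?P)" by simp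
  moreover have "det (?P * ?Q) = det ?P * det ?Q"
    by (rule det_mult[of _ "n + m"]) (rule four_block_carrier_mat; use car in simp)+
  moreover have "det (?S * ?P) = det ?S * det ?P"
    by (rule det_mult[of _ "n + m"]) (rule four_block_carrier_mat; use car in simp)+
  moreover have "det ?P = det (1\<^sub>m n) * det (1\<^sub>m m)"
    by (rule det_four_block_mat_upper_right_zero) (use car in auto)
  moreover have "det ?Q = det (1\<^sub>m n + A * B) * det (1\<^sub>m m)"
    by (rule det_four_block_mat_lower_left_zero) (use car in auto)
  moreover have "det ?S = det (1\<^sub>m n) * det (1\<^sub>m m + B * A)"
    by (rule det_four_block_mat_lower_left_zero) (use car in auto)
  ultimately show ?thesis by simp
qed

text \<open>After factoring out \<open>a\<close>, Sylvester's identity turns column times row into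
  row times column and leaves a 1 by 1 determinant.\<close>

lemma det_diag_plus_rank_one:
  fixes a t :: real
  assumes a: "a \<noteq> 0"
  shows "det (mat n n (\<lambda>(i, j). (if i = j then a else 0) + t * u i * u j)) =
    a ^ n * (1 + t / a * (\<Sum>i<n. (u i)\<^sup>2))"
proof -
  let ?A = "mat n 1 (\<lambda>(i, j). t / a * u i)" and ?B = "mat 1 n (\<lambda>(i, j). u j)"
  have "mat n n (\<lambda>(i, j). (if i = j then a else 0) + t * u i * u j) = a \<cdot>\<^sub>m (1\<^sub>m n + ?A * ?B)"
    using a by (intro eq_matI) (auto simp: scalar_prod_def field_simps)
  moreover have "det (1\<^sub>m n + ?A * ?B) = det (1\<^sub>m 1 + ?B * ?A)"
    by (rule det_one_plus_mult_commute) auto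
  moreover have "det (1\<^sub>m 1 + ?B * ?A) = 1 + t / a * (\<Sum>i<n. (u i)\<^sup>2)"
    by (subst det_single)
      (auto simp: scalar_prod_def sum_distrib_left power2_eq_square lessThan_atLeast0 intro!: sum.cong)
  ultimately show ?thesis by simp
qed

section \<open>The two analytic estimates: a global bound by the trace, and a first-order
  condition\<close>

text \<open>Hadamard reduces the claim to the product of the diagonal entries, whose sum is the
  trace. The AM-GM step uses \<open>x \<le> exp (x - 1)\<close> in each factor.\<close>

lemma det_weighted_gram_le:
  fixes z :: "nat \<Rightarrow> nat \<Rightarrow> real"
  assumes n: "0 < n" and q: "\<And>i. i < m \<Longrightarrow> 0 \<le> q i"
    and trace: "(\<Sum>i<m. q i * (\<Sum>a<n. (z i a)\<^sup>2)) \<le> 1"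
  shows "det (mat n n (\<lambda>(a, b). \<Sum>i<m. q i * z i a * z i b)) \<le> (1 / real n) ^ n"
proof -
  \<comment> \<open>The factor \<open>real n\<close> brings the optimal diagonal entries
    \<open>1 / n\<close> to 1, where \<open>x \<le> exp (x - 1)\<close> is an equality.\<close>
  define f where "f i a = sqrt (real n * q i) * z i a" for i a
  have f: "f i a * f i b = real n * (q i * z i a * z i b)" if "i < m" for i a b
  proof -
    have "f i a * f i b = (sqrt (real n * q i))\<^sup>2 * (z i a * z i b)"
      by (simp add: f_def power2_eq_square del: real_sqrt_mult_self real_sqrt_pow2)
    then show ?thesis using q[OF that] by simp
  qed
  have "mat n n (\<lambda>(a, b). \<Sum>i<m. f i a * f i b) =
      real n \<cdot>\<^sub>m mat n n (\<lambda>(a, b). \<Sum>i<m. q i * z i a * z i b)"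
    by (intro eq_matI) (auto simp: f sum_distrib_left)
  then have "real n ^ n * det (mat n n (\<lambda>(a, b). \<Sum>i<m. q i * z i a * z i b)) =
      det (mat n n (\<lambda>(a, b). \<Sum>i<m. f i a * f i b))" by simp
  also have "\<dots> \<le> (\<Prod>a<n. \<Sum>i<m. (f i a)\<^sup>2)" by (rule det_gram_le_prod)
  also have "\<dots> \<le> (\<Prod>a<n. exp ((\<Sum>i<m. (f i a)\<^sup>2) - 1))"
  proof (rule prod_mono, safe)
    fix a
    show "(\<Sum>i<m. (f i a)\<^sup>2) \<le> exp ((\<Sum>i<m. (f i a)\<^sup>2) - 1)"
      using exp_ge_add_one_self[of "(\<Sum>i<m. (f i a)\<^sup>2) - 1"] by simp
  qed (simp add: sum_nonneg)
  also have "\<dots> = exp ((\<Sum>a<n. \<Sum>i<m. (f i a)\<^sup>2) - real n)"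
    by (simp add: exp_sum[symmetric] sum_subtractf)
  also have "(\<Sum>a<n. \<Sum>i<m. (f i a)\<^sup>2) = real n * (\<Sum>i<m. q i * (\<Sum>a<n. (z i a)\<^sup>2))"
    by (subst sum.swap) (simp add: power2_eq_square f sum_distrib_left mult_ac)
  also have "exp (real n * (\<Sum>i<m. q i * (\<Sum>a<n. (z i a)\<^sup>2)) - real n) \<le> 1"
    using mult_left_mono[OF trace, of "real n"] by simp
  finally show ?thesis using n by (simp add: field_simps)
qed

text \<open>The bounded expression is the determinant after moving mass \<open>t\<close> to a point
  with squared length \<open>c\<close>. It equals \<open>(1 / n) ^ n\<close> at
  \<open>t = 0\<close>, and its slope there is \<open>n * (c - 1)\<close> times that value, so
  \<open>c > 1\<close> would violate the bound for small \<open>t\<close>.\<close>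

lemma le_one_if_power_bound:
  fixes c :: real
  assumes n: "0 < n" and c: "0 \<le> c"
    and bound: "\<And>t. 0 < t \<Longrightarrow> t < 1 \<Longrightarrow> ((1 - t) / real n) ^ n * (1 + t / ((1 - t) / real n) * c) \<le> (1 / real n) ^ n"
  shows "c \<le> 1"
proof (rule ccontr)
  assume "\<not> c \<le> 1"
  then have c1: "1 < c" by simp
  obtain k where k: "n = Suc k" using n by (cases n) auto
  \<comment> \<open>Bernoulli's inequality replaces the power by \<open>1 - k * t\<close>;
    cancelling one factor \<open>t\<close> leaves a right side that tends to 0 with
    \<open>t\<close>.\<close>
  have key: "real n * (c - 1) \<le> t * (real k * (real n * c - 1))" if t: "0 < t" "t < 1" for t
  proof -
    have "((1 - t) / real n) ^ n * (1 + t / ((1 - t) / real n) * c) =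
        (1 / real n) ^ n * ((1 - t) ^ k * (1 - t + t * real n * c))"
    proof -
      have "1 + t / ((1 - t) / real n) * c = (1 - t + t * real n * c) / (1 - t)"
        using t n by (simp add: field_simps)
      moreover have "((1 - t) / real n) ^ n = (1 / real n) ^ n * (1 - t) ^ k * (1 - t)"
        by (simp add: k power_divide)
      ultimately show ?thesis using t by simp
    qed
    with bound[OF t] have "(1 / real n) ^ n * ((1 - t) ^ k * (1 - t + t * real n * c)) \<le> (1 / real n) ^ n * 1"
      by simp
    then have le: "(1 - t) ^ k * (1 - t + t * real n * c) \<le> 1"
      using n by (subst (asm) mult_le_cancel_left_pos) auto
    have "1 - real k * t \<le> (1 - t) ^ k"
      using Bernoulli_inequality[of "- t" k] t by (simp add: mult.commute)
    then have "(1 - real k * t) * (1 - t + t * real n * c) \<le> 1"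
      using le t c by (intro order_trans[OF mult_right_mono le]) simp_all
    then have "t * (real n * (c - 1)) \<le> t * (t * (real k * (real n * c - 1)))"
      by (simp add: k algebra_simps)
    then show ?thesis using t by (simp add: mult_le_cancel_left_pos)
  qed
  let ?L = "\<lambda>t. t * (real k * (real n * c - 1))"
  have "(?L \<longlongrightarrow> 0 * (real k * (real n * c - 1))) (at_right 0)"
    by (intro tendsto_intros)
  moreover have "eventually (\<lambda>t. real n * (c - 1) \<le> ?L t) (at_right 0)"
    unfolding eventually_at_right_field using key by (intro exI[of _ 1]) auto
  ultimately have "real n * (c - 1) \<le> 0"
    by (intro tendsto_lowerbound[of ?L 0 "at_right 0"]) auto
  then show False using c1 n by (simp add: mult_le_0_iff)
qed

section \<open>Ordered row selections and Cramer's rule\<close>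

text \<open>Rows are listed by a function instead of a set, so that an exchange is
  \<open>f(a := i)\<close> and the new row stays in position \<open>a\<close>, as Cramer's rule
  requires.\<close>

definition select_rows :: "'a mat \<Rightarrow> nat \<Rightarrow> (nat \<Rightarrow> nat) \<Rightarrow> 'a mat" where
  "select_rows A n f = mat n (dim_col A) (\<lambda>(i, j). A $$ (f i, j))"

text \<open>Both matrices contain the same rows up to order; the sign of the sorting permutation
  disappears on squaring.\<close>

lemma det_select_rows_square:
  fixes A :: "'a::idom mat"
  assumes A: "A \<in> carrier_mat m d"
    and inj: "inj_on f {0..<d}" and range: "f ` {0..<d} \<subseteq> {..<m}"
  shows "(det (select_rows A d f))\<^sup>2 = (det (submatrix A (f ` {0..<d}) UNIV))\<^sup>2"
proof -
  define K where "K = f ` {0..<d}"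
  let ?S = "submatrix A K UNIV"
  have K: "{i. i < dim_row A \<and> i \<in> K} = K" "finite K" "card K = d"
    using A range inj by (auto simp: K_def card_image)
  have cols: "card {j. j < dim_col A \<and> j \<in> UNIV} = d" using A by simp
  have S: "?S \<in> carrier_mat d d"
    by (rule carrier_matI) (simp_all only: dim_submatrix K cols)
  \<comment> \<open>\<open>p i\<close> is the rank of \<open>f i\<close> in \<open>K\<close>, the
    index at which \<open>pick\<close> finds it. From \<open>d\<close> on it is the identity, as
    \<open>permutes\<close> demands.\<close>
  define p where "p i = (if i < d then card {a \<in> K. a < f i} else i)" for i
  have pick: "pick K (p i) = f i" if "i < d" for i
    using that by (simp add: p_def pick_card_in_set K_def)
  have lt: "p i < d" if "i < d" for i
  proof -
    have "{a \<in> K. a < f i} \<subset> K" using that by (auto simp: K_def)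
    then show ?thesis using that K psubset_card_mono[of K] by (simp add: p_def)
  qed
  have "inj_on p {0..<d}"
    using pick inj by (metis (no_types, lifting) atLeastLessThan_iff inj_on_def)
  moreover have "p ` {0..<d} \<subseteq> {0..<d}" using lt by auto
  ultimately have "bij_betw p {0..<d} {0..<d}"
    by (simp add: bij_betw_def endo_inj_surj)
  then have perm: "p permutes {0..<d}"
    by (rule bij_imp_permutes) (simp add: p_def)
  have "?S $$ (p i, j) = A $$ (f i, j)" if "i < d" "j < d" for i j
    using submatrix_index[of "p i" A K j UNIV] lt that by (simp only: K cols pick pick_UNIV)
  then have "select_rows A d f = mat d d (\<lambda>(i, j). ?S $$ (p i, j))"
    using A by (intro eq_matI) (auto simp: select_rows_def)
  then have "det (select_rows A d f) = signof p * det ?S"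
    using det_permute_rows[OF S perm] by simp
  moreover have "(signof p :: 'a)\<^sup>2 = 1"
    using signof_pm_one[of p, where 'a = 'a] by (auto simp: power2_eq_square)
  ultimately show ?thesis by (simp add: power_mult_distrib K_def)
qed

lemma det_mat_diag: "det (mat_diag n f) = (\<Prod>i<n. f i)"
  by (subst det_upper_triangular[of _ n])
    (auto simp: mat_diag_def upper_triangular_def prod_list_diag_prod lessThan_atLeast0)

lemma det_select_rows_scaled:
  fixes A :: "'a::idom mat"
  assumes A: "A \<in> carrier_mat m d" and f: "\<And>a. a < d \<Longrightarrow> f a < m"
  shows "det (select_rows (mat_diag m s * A) d f) = (\<Prod>a<d. s (f a)) * det (select_rows A d f)"
proof -
  have sel: "select_rows A d f \<in> carrier_mat d d" using A by (simp add: select_rows_def)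
  have "select_rows (mat_diag m s * A) d f = mat_diag d (\<lambda>a. s (f a)) * select_rows A d f"
    using A f by (simp add: mat_diag_mult_left[OF A] mat_diag_mult_left[OF sel])
      (auto simp: select_rows_def)
  then show ?thesis using sel by (simp add: det_mult[OF mat_diag_dim] det_mat_diag)
qed

text \<open>Cramer's rule, read row-wise: each row of \<open>Z * P\<close> is a combination of the rows of \<open>P\<close>.\<close>

lemma det_replace_row:
  fixes Z P :: "'a::field mat"
  assumes Z: "Z \<in> carrier_mat m d" and P: "P \<in> carrier_mat d d"
    and sel: "select_rows (Z * P) d f = P" and i: "i < m" and a: "a < d"
  shows "det (select_rows (Z * P) d (f(a := i))) = Z $$ (i, a) * det P"
proof -
  let ?R = "select_rows (Z * P) d (f(a := i))"
  have entry: "P $$ (b, j) = (Z * P) $$ (f b, j)" if "b < d" "j < d" for b j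
    using arg_cong[OF sel, of "\<lambda>M. M $$ (b, j)"] P that by (simp add: select_rows_def)
  \<comment> \<open>\<open>cramer_lemma_mat\<close> replaces a column, hence the transposes: row
    \<open>i\<close> of \<open>Z * P\<close> is the transpose of \<open>P\<close> applied to row
    \<open>i\<close> of \<open>Z\<close>.\<close>
  have "transpose_mat ?R = replace_col (transpose_mat P) (transpose_mat P *\<^sub>v row Z i) a"
    using Z P i by (intro eq_matI)
      (auto simp: select_rows_def replace_col_def entry comm_scalar_prod[of _ d])
  moreover have "det (transpose_mat ?R) = det ?R"
    by (rule det_transpose[of _ d]) (use P in \<open>simp add: select_rows_def\<close>)
  ultimately have "det ?R = row Z i $ a * det (transpose_mat P)"
    using cramer_lemma_mat[of "transpose_mat P" d "row Z i" a] Z P i a by simp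
  then show ?thesis using Z P i a by (simp add: det_transpose[of _ d])
qed

lemma weighted_gram_entries:
  fixes A :: "'a::comm_semiring_1 mat"
  assumes "A \<in> carrier_mat m d"
  shows "transpose_mat A * mat_diag m q * A =
    mat d d (\<lambda>(a, b). \<Sum>i<m. q i * A $$ (i, a) * A $$ (i, b))"
proof -
  have At: "transpose_mat A \<in> carrier_mat d m" using assms by simp
  show ?thesis unfolding mat_diag_mult_right[OF At]
    using assms by (intro eq_matI) (auto simp: scalar_prod_def lessThan_atLeast0 mult_ac)
qed

section \<open>Normalized coordinates and the optimality criterion\<close>

theorem theorem3p2:
  fixes m d :: nat
    and X :: "real mat"
    and w :: "nat \<Rightarrow> real"
    and I :: "nat set"
  assumes "1 \<le> d" and "d \<le> m"
    and "X \<in> carrier_mat m d"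
    and "inj_on (row X) {..<m}"
    and "\<forall>i<m. w i > 0"
    and "I \<subseteq> {..<m}" and "card I = d"
    and "det (submatrix X I UNIV) \<noteq> 0"
  shows "D_optimal X w (uniform_design m I) \<longleftrightarrow>
    (\<forall>i<m. i \<notin> I \<longrightarrow>
      (\<Sum>j\<in>I. (det (submatrix X ({i} \<union> (I - {j})) UNIV))\<^sup>2 / w j)
        \<le> (det (submatrix X I UNIV))\<^sup>2 / w i)"
proof -
  note X = \<open>X \<in> carrier_mat m d\<close>
  have w: "0 < w i" if "i < m" for i using assms that by simp
  have d: "0 < d" using assms by simp
  have "finite I" using \<open>I \<subseteq> {..<m}\<close> finite_subset by blast
  then obtain f where f: "bij_betw f {0..<d} I"
    using ex_bij_betw_nat_finite \<open>card I = d\<close> by blast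
  have inj: "inj_on f {0..<d}" and img: "f ` {0..<d} = I"
    using f by (auto simp: bij_betw_def)
  have fm: "f a < m" if "a < d" for a
  proof -
    have "f a \<in> I" using that img by force
    then show ?thesis using \<open>I \<subseteq> {..<m}\<close> by auto
  qed
  have sum_I: "(\<Sum>j\<in>I. g j) = (\<Sum>a<d. g (f a))" for g :: "nat \<Rightarrow> real"
    using sum.reindex_bij_betw[OF f, of g] by (simp add: lessThan_atLeast0)

  \<comment> \<open>Absorbing \<open>sqrt (w i)\<close> into row \<open>i\<close> leaves only the
    masses as weights in the information matrix.\<close>
  define V where "V = mat_diag m (\<lambda>i. sqrt (w i)) * X"
  define P where "P = select_rows V d f"
  have V: "V \<in> carrier_mat m d" unfolding V_def by (rule mult_carrier_mat[OF mat_diag_dim X])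
  have P: "P \<in> carrier_mat d d" using V by (simp add: P_def select_rows_def)
  \<comment> \<open>Kept general in \<open>g\<close>, since it serves both the enumeration
    \<open>f\<close> of \<open>I\<close> and its exchanges \<open>f(a := i)\<close>.\<close>
  have det_V_sq: "(det (select_rows V d g))\<^sup>2 =
      (\<Prod>a<d. w (g a)) * (det (submatrix X (g ` {0..<d}) UNIV))\<^sup>2"
    if "inj_on g {0..<d}" "\<And>a. a < d \<Longrightarrow> g a < m" for g
  proof -
    have "det (select_rows V d g) = (\<Prod>a<d. sqrt (w (g a))) * det (select_rows X d g)"
      unfolding V_def using X that by (intro det_select_rows_scaled) auto
    moreover have "(\<Prod>a<d. sqrt (w (g a)))\<^sup>2 = (\<Prod>a<d. w (g a))"
      unfolding prod_power_distrib using w that(2) by (intro prod.cong) (auto simp: less_imp_le)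
    moreover have "(det (select_rows X d g))\<^sup>2 = (det (submatrix X (g ` {0..<d}) UNIV))\<^sup>2"
      by (rule det_select_rows_square[OF X]) (use that in auto)
    ultimately show ?thesis by (simp add: power_mult_distrib)
  qed
  define W where "W = (\<Prod>a<d. w (f a))"
  define D where "D = (det (submatrix X I UNIV))\<^sup>2"
  have W: "0 < W" unfolding W_def using w fm by (intro prod_pos) auto
  have D: "0 < D" using assms by (simp add: D_def)
  have det_P: "(det P)\<^sup>2 = W * D"
    using det_V_sq[OF inj fm] by (simp add: P_def W_def D_def img)
  with W D have "det P \<noteq> 0" by auto
  then obtain B where B: "B \<in> carrier_mat d d" and BP: "B * P = 1\<^sub>m d"
    using det_non_zero_imp_unit[OF P, of "()"] by (auto simp: Units_def ring_mat_def)
  have PB: "P * B = 1\<^sub>m d" by (rule mat_mult_left_right_inverse[OF B P BP])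
  \<comment> \<open>\<open>B\<close> is the inverse of \<open>P\<close>, so the rows of
    \<open>Z\<close> are the coordinates of the rows of \<open>V\<close> in the basis given by
    \<open>I\<close>.\<close>
  define Z where "Z = V * B"
  have Z: "Z \<in> carrier_mat m d" using V B by (simp add: Z_def)
  have ZP: "Z * P = V" using V B P BP by (simp add: Z_def)
  have Z_f: "Z $$ (f a, b) = (if a = b then 1 else 0)" if "a < d" "b < d" for a b
  proof -
    have "row V (f a) = row P a"
      using V that fm by (intro eq_vecI) (auto simp: P_def select_rows_def)
    then have "Z $$ (f a, b) = (P * B) $$ (a, b)"
      using V B P that fm by (simp add: Z_def)
    then show ?thesis using that by (simp add: PB)
  qed

  \<comment> \<open>The information matrix in the new coordinates. Its determinant differs from the
    original one by the factor \<open>(det P)\<^sup>2\<close>, which is independent of the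
    design.\<close>
  define G where "G q = mat d d (\<lambda>(a, b). \<Sum>i<m. q $ i * Z $$ (i, a) * Z $$ (i, b))" for q :: "real vec"
  have det_info: "det (information_mat X w q) = (det P)\<^sup>2 * det (G q)" for q
  proof -
    have "information_mat X w q = transpose_mat V * mat_diag m (\<lambda>i. q $ i) * V"
      using X w unfolding information_mat_def weighted_gram_entries[OF V]
      by (simp add: weighted_gram_entries[OF X])
        (auto simp: V_def mat_diag_mult_left[OF X] intro!: eq_matI sum.cong,
         metis (no_types, opaque_lifting) less_imp_le mult.assoc mult.left_commute real_sqrt_mult_self abs_of_nonneg)
    also have "\<dots> = transpose_mat P * (transpose_mat Z * mat_diag m (\<lambda>i. q $ i) * Z) * P"
    proof -
      let ?Pt = "transpose_mat P" and ?Zt = "transpose_mat Z" and ?Q = "mat_diag m (\<lambda>i. q $ i)"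
      have Pt: "?Pt \<in> carrier_mat d d" and Zt: "?Zt \<in> carrier_mat d m" and Q: "?Q \<in> carrier_mat m m"
        using Z P by auto
      note ZtQ = mult_carrier_mat[OF Zt Q]
      have "?Pt * ?Zt * ?Q * (Z * P) = ?Pt * (?Zt * ?Q) * (Z * P)"
        by (simp only: assoc_mult_mat[OF Pt Zt Q])
      also have "\<dots> = ?Pt * (?Zt * ?Q) * Z * P"
        by (simp only: assoc_mult_mat[OF mult_carrier_mat[OF Pt ZtQ] Z P])
      also have "\<dots> = ?Pt * (?Zt * ?Q * Z) * P"
        by (simp only: assoc_mult_mat[OF Pt ZtQ Z])
      finally show ?thesis
        unfolding ZP[symmetric] transpose_mult[OF Z P] .
    qed
    also have "\<dots> = transpose_mat P * G q * P"
      unfolding weighted_gram_entries[OF Z] G_def ..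
    finally have "information_mat X w q = transpose_mat P * G q * P" .
    moreover have "G q \<in> carrier_mat d d" by (simp add: G_def)
    ultimately show ?thesis
      using P by (simp add: det_mult[of _ d] det_transpose[of _ d] power2_eq_square)
  qed
  have G_uniform: "(\<Sum>i<m. uniform_design m I $ i * Z $$ (i, a) * Z $$ (i, b)) =
      (if a = b then 1 / real d else 0)" if "a < d" "b < d" for a b
  proof -
    have "(\<Sum>i<m. uniform_design m I $ i * Z $$ (i, a) * Z $$ (i, b)) =
        (\<Sum>i\<in>I. 1 / real d * Z $$ (i, a) * Z $$ (i, b))"
      using assms by (intro sum.mono_neutral_cong_right) (auto simp: uniform_design_def)
    also have "\<dots> = (\<Sum>c<d. if c = a then if a = b then 1 / real d else 0 else 0)"
      unfolding sum_I using that by (intro sum.cong) (auto simp: Z_f)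
    finally show ?thesis using that by simp
  qed
  have alloc: "allocation m (uniform_design m I)"
    using assms d by (intro allocation_uniform_design) auto
  have det_uniform: "det (G (uniform_design m I)) = (1 / real d) ^ d"
  proof -
    have "G (uniform_design m I) = (1 / real d) \<cdot>\<^sub>m 1\<^sub>m d"
      by (intro eq_matI) (auto simp: G_def G_uniform)
    then show ?thesis by simp
  qed
  have optimal_iff: "D_optimal X w (uniform_design m I) \<longleftrightarrow>
      (\<forall>q. allocation m q \<longrightarrow> det (G q) \<le> (1 / real d) ^ d)"
    using X alloc \<open>det P \<noteq> 0\<close> by (simp add: D_optimal_def det_info det_uniform)

  define N where "N i = (\<Sum>a<d. (Z $$ (i, a))\<^sup>2)" for i
  have N_I: "N i = 1" if "i \<in> I" for i
  proof -
    have "i \<in> f ` {0..<d}" using that img by simp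
    then obtain c where c: "c < d" "i = f c" by auto
    then have "N i = (\<Sum>a<d. if a = c then 1 else 0)"
      unfolding N_def by (intro sum.cong) (auto simp: Z_f)
    then show ?thesis using c by simp
  qed
  have N: "N i \<le> 1 \<longleftrightarrow> (\<Sum>j\<in>I. (det (submatrix X ({i} \<union> (I - {j})) UNIV))\<^sup>2 / w j) \<le> D / w i"
    if i: "i < m" "i \<notin> I" for i
  proof -
    define E where "E j = (det (submatrix X ({i} \<union> (I - {j})) UNIV))\<^sup>2" for j
    \<comment> \<open>Cramer's rule gives \<open>Z $$ (i, a)\<close> as a ratio of determinants.
      After squaring, exchanging \<open>f a\<close> for \<open>i\<close> changes the weight product
      \<open>W\<close> by the factor \<open>w i / w (f a)\<close>.\<close>
    have "(Z $$ (i, a))\<^sup>2 * (W * D) = W * w i * (E (f a) / w (f a))" if a: "a < d" for a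
    proof -
      let ?g = "f(a := i)"
      have "inj_on ?g {0..<d}"
        using inj i img by (intro inj_on_fun_updI) auto
      moreover have "?g ` {0..<d} = {i} \<union> (I - {f a})"
      proof -
        have "?g ` {0..<d} = insert i (f ` ({0..<d} - {a}))" using a by (auto simp: fun_upd_image)
        also have "f ` ({0..<d} - {a}) = I - {f a}"
          using inj a img by (subst inj_on_image_set_diff[OF inj]) auto
        finally show ?thesis by simp
      qed
      moreover have "(\<Prod>b<d. w (?g b)) = W * w i / w (f a)"
      proof -
        have "(\<Prod>b<d. w (?g b)) = w i * (\<Prod>b\<in>{..<d} - {a}. w (f b))"
          using a by (subst prod.remove[of _ a]) (auto intro!: prod.cong)
        moreover have "W = w (f a) * (\<Prod>b\<in>{..<d} - {a}. w (f b))"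
          unfolding W_def using a by (subst prod.remove[of _ a]) auto
        ultimately show ?thesis using w[OF fm[OF a]] by simp
      qed
      ultimately have "(det (select_rows V d ?g))\<^sup>2 = W * w i / w (f a) * E (f a)"
        using det_V_sq[of ?g] fm i by (simp add: E_def)
      moreover have "det (select_rows V d ?g) = Z $$ (i, a) * det P"
        using det_replace_row[OF Z P _ i(1) a, of f] by (simp add: ZP P_def[symmetric])
      ultimately show ?thesis by (simp add: power_mult_distrib det_P)
    qed
    then have "N i * (W * D) = W * w i * (\<Sum>j\<in>I. E j / w j)"
      unfolding sum_I N_def sum_distrib_right sum_distrib_left by (intro sum.cong) auto
    then have "N i * D = w i * (\<Sum>j\<in>I. E j / w j)" using W by simp
    moreover have "N i \<le> 1 \<longleftrightarrow> N i * D \<le> D" using D by simp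
    ultimately show ?thesis using w[OF i(1)] unfolding E_def
      by (simp add: pos_le_divide_eq mult.commute)
  qed

  have "D_optimal X w (uniform_design m I) \<longleftrightarrow> (\<forall>i<m. i \<notin> I \<longrightarrow> N i \<le> 1)"
    unfolding optimal_iff
  proof (intro iffI allI impI)
    fix i assume opt: "\<forall>q. allocation m q \<longrightarrow> det (G q) \<le> (1 / real d) ^ d"
      and i: "i < m" "i \<notin> I"
    show "N i \<le> 1"
    proof (rule le_one_if_power_bound[OF d])
      show "0 \<le> N i" by (simp add: N_def sum_nonneg)
      fix t :: real assume t: "0 < t" "t < 1"
      \<comment> \<open>A move of mass \<open>t\<close> to the point \<open>i\<close>; its matrix
        \<open>G q\<close> is \<open>(1 - t) / d\<close> times the identity plus a rank-one
        term.\<close>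
      define q where "q = vec m (\<lambda>k. (1 - t) * uniform_design m I $ k + (if k = i then t else 0))"
      have "allocation m q"
        using alloc t i
        by (auto simp: allocation_def q_def sum.distrib sum_distrib_left[symmetric])
      moreover have "det (G q) = ((1 - t) / real d) ^ d * (1 + t / ((1 - t) / real d) * N i)"
      proof -
        have "(\<Sum>k<m. q $ k * Z $$ (k, a) * Z $$ (k, b)) =
            (if a = b then (1 - t) / real d else 0) + t * Z $$ (i, a) * Z $$ (i, b)"
          if ab: "a < d" "b < d" for a b
        proof -
          have "(\<Sum>k<m. q $ k * Z $$ (k, a) * Z $$ (k, b)) =
              (\<Sum>k<m. (1 - t) * (uniform_design m I $ k * Z $$ (k, a) * Z $$ (k, b))
                + (if k = i then t * Z $$ (i, a) * Z $$ (i, b) else 0))"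
            by (rule sum.cong) (auto simp: q_def algebra_simps)
          also have "\<dots> = (1 - t) * (if a = b then 1 / real d else 0) + t * Z $$ (i, a) * Z $$ (i, b)"
            using i by (simp add: sum.distrib sum_distrib_left[symmetric] G_uniform[OF ab])
          finally show ?thesis by simp
        qed
        then have "G q = mat d d (\<lambda>(a, b). (if a = b then (1 - t) / real d else 0) + t * Z $$ (i, a) * Z $$ (i, b))"
          unfolding G_def by (intro eq_matI) auto
        then show ?thesis
          using det_diag_plus_rank_one[of "(1 - t) / real d" d t "\<lambda>a. Z $$ (i, a)"] t d
          by (simp add: N_def)
      qed
      ultimately show "((1 - t) / real d) ^ d * (1 + t / ((1 - t) / real d) * N i) \<le> (1 / real d) ^ d"
        using opt by metis
    qed
  next
    fix q assume le: "\<forall>i<m. i \<notin> I \<longrightarrow> N i \<le> 1" and q: "allocation m q"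
    \<comment> \<open>Rows in \<open>I\<close> are unit vectors. Hence \<open>N\<close> is at most 1
      everywhere, and the trace of \<open>G q\<close>, an average of \<open>N\<close> under
      \<open>q\<close>, is at most 1.\<close>
    have "N i \<le> 1" if "i < m" for i using le N_I that by (cases "i \<in> I") auto
    then have "(\<Sum>i<m. q $ i * N i) \<le> (\<Sum>i<m. q $ i)"
      using q by (intro sum_mono) (auto simp: allocation_def mult_left_le)
    then have "(\<Sum>i<m. q $ i * N i) \<le> 1" using q by (simp add: allocation_def)
    then show "det (G q) \<le> (1 / real d) ^ d"
      unfolding G_def N_def using q by (intro det_weighted_gram_le d) (auto simp: allocation_def)
  qed
  then show ?thesis using N by (simp add: D_def)
qed

end
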